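(* Let $c$ be the Banach space of convergent real sequences with the supremum norm. There exists a subgroup $G\leqslant \mathrm{Isom}(c)$ which has a distinguished point in $c$, but whose dual action on $c^*\simeq\ell_1$ is not SOT-discrete. In particular, the space $c$ is not light.
   Context: $\mathrm{Isom}(X)$ is the group of surjective linear isometries of a Banach space $X$. A point $x\in X$ is distinguished for a bounded group $G$ of isomorphisms of $X$ if $\inf_{T\in G,\,T\neq \mathrm{Id}}\|Tx-x\|>0$. The dual action of $G$ on $X^*$ is $T\cdot x^*=x^*\circ T^{-1}$; it is SOT-discrete if the group of operators $\{x^*\mapsto x^*\circ T^{-1}: T\in G\}\leqslant \mathrm{GL}(X^* )$ is discrete in the Strong Operator Topology (SOT, pointwise norm convergence on $X^*$). The Weak Operator Topology (WOT) on operators on $X$ is generated by the maps $T\mapsto x^*(Tx)$, $x\in X$, $x^*\in X^*$. A group of isomorphisms of $X$ is light if the WOT and the SOT coincide on it; a Banach space $X$ is light if $\mathrm{Isom}(X)$ is light. *)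

theory Defs
  imports "HOL-Analysis.Analysis" "HOL-Algebra.Group"
begin

section \<open>The Banach space of convergent real sequences\<close>

typedef cseq = "{x :: nat \<Rightarrow> real. convergent x}"
  morphisms seq_of Cseq
  by (auto intro: convergent_const)

setup_lifting type_definition_cseq

lemma convergent_seq_of: "convergent (seq_of x)"
  using seq_of[of x] by simp

lemma cseq_eqI: "(\<And>n. seq_of x n = seq_of y n) \<Longrightarrow> x = y"
  by (metis seq_of_inject ext)

instantiation cseq :: real_vector
begin

lift_definition zero_cseq :: cseq is "\<lambda>_. 0"
  by (rule convergent_const)
lift_definition plus_cseq :: "cseq \<Rightarrow> cseq \<Rightarrow> cseq" is "\<lambda>x y n. x n + y n"
  by (rule convergent_add)
lift_definition minus_cseq :: "cseq \<Rightarrow> cseq \<Rightarrow> cseq" is "\<lambda>x y n. x n - y n"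
  by (rule convergent_diff)
lift_definition uminus_cseq :: "cseq \<Rightarrow> cseq" is "\<lambda>x n. - x n"
  by (simp add: convergent_minus_iff[symmetric])
lift_definition scaleR_cseq :: "real \<Rightarrow> cseq \<Rightarrow> cseq" is "\<lambda>r x n. r * x n"
  by (auto simp: convergent_def intro: tendsto_mult_left)

lemmas seq_of_simps [simp] =
  zero_cseq.rep_eq plus_cseq.rep_eq minus_cseq.rep_eq uminus_cseq.rep_eq scaleR_cseq.rep_eq

instance
  by standard (auto intro!: cseq_eqI simp: algebra_simps)

end

lemma bdd_above_seq_of: "bdd_above (range (\<lambda>n. \<bar>seq_of x n\<bar>))"
proof -
  have "Bseq (seq_of x)"
    by (rule convergent_imp_Bseq[OF convergent_seq_of])
  then obtain K where "\<And>n. norm (seq_of x n) \<le> K"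
    by (auto simp: Bseq_def)
  then show ?thesis
    by (auto intro!: bdd_aboveI[where M = K])
qed

instantiation cseq :: real_normed_vector
begin

definition norm_cseq :: "cseq \<Rightarrow> real"
  where "norm_cseq x = (SUP n. \<bar>seq_of x n\<bar>)"

definition dist_cseq :: "cseq \<Rightarrow> cseq \<Rightarrow> real"
  where "dist_cseq x y = norm (x - y)"

definition sgn_cseq :: "cseq \<Rightarrow> cseq"
  where "sgn_cseq x = x /\<^sub>R norm x"

definition uniformity_cseq :: "(cseq \<times> cseq) filter"
  where "uniformity_cseq = (INF e\<in>{0 <..}. principal {(x, y). dist x y < e})"

definition open_cseq :: "cseq set \<Rightarrow> bool"
  where "open_cseq S = (\<forall>x\<in>S. \<forall>\<^sub>F (x', y) in uniformity. x' = x \<longrightarrow> y \<in> S)"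

lemma abs_seq_of_le_norm: "\<bar>seq_of x n\<bar> \<le> norm x"
  unfolding norm_cseq_def by (rule cSUP_upper[OF _ bdd_above_seq_of]) simp

lemma norm_cseq_leI: "(\<And>n. \<bar>seq_of x n\<bar> \<le> b) \<Longrightarrow> norm x \<le> b"
  unfolding norm_cseq_def by (rule cSUP_least) auto

instance
proof
  fix x y :: cseq and a :: real
  show "norm x = 0 \<longleftrightarrow> x = 0"
  proof
    assume "norm x = 0"
    then show "x = 0"
      using abs_seq_of_le_norm[of x] by (intro cseq_eqI) simp
  next
    assume "x = 0"
    then show "norm x = 0"
      by (simp add: norm_cseq_def)
  qed
  show "norm (x + y) \<le> norm x + norm y"
  proof (rule norm_cseq_leI)
    fix n
    show "\<bar>seq_of (x + y) n\<bar> \<le> norm x + norm y"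
      using abs_seq_of_le_norm[of x n] abs_seq_of_le_norm[of y n] by simp
  qed
  have le: "norm (b *\<^sub>R z) \<le> \<bar>b\<bar> * norm z" for b :: real and z :: cseq
    by (rule norm_cseq_leI) (simp add: abs_mult mult_left_mono abs_seq_of_le_norm)
  show "norm (a *\<^sub>R x) = \<bar>a\<bar> * norm x"
  proof (cases "a = 0")
    case True
    then show ?thesis by (simp add: norm_cseq_def)
  next
    case False
    have "\<bar>a\<bar> * norm x = \<bar>a\<bar> * norm (inverse a *\<^sub>R (a *\<^sub>R x))"
      using False by simp
    also have "\<dots> \<le> \<bar>a\<bar> * (\<bar>inverse a\<bar> * norm (a *\<^sub>R x))"
      by (intro mult_left_mono le) simp
    also have "\<dots> = norm (a *\<^sub>R x)"
      using False by (simp add: abs_inverse)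
    finally show ?thesis
      using le[of a x] by simp
  qed
qed (rule dist_cseq_def sgn_cseq_def uniformity_cseq_def open_cseq_def)+

end

instance cseq :: banach
proof
  fix f :: "nat \<Rightarrow> cseq"
  assume "Cauchy f"
  have ev: "\<exists>M. \<forall>m\<ge>M. \<forall>n\<ge>M. norm (f m - f n) < e" if "0 < e" for e
    using that \<open>Cauchy f\<close> unfolding Cauchy_iff by blast
  have coord: "Cauchy (\<lambda>m. seq_of (f m) k)" for k
    unfolding Cauchy_iff
  proof (intro allI impI)
    fix e :: real assume "0 < e"
    then obtain M where "\<forall>m\<ge>M. \<forall>n\<ge>M. norm (f m - f n) < e"
      using ev by blast
    moreover have "norm (seq_of (f m) k - seq_of (f n) k) \<le> norm (f m - f n)" for m n
      using abs_seq_of_le_norm[of "f m - f n" k] by simp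
    ultimately show "\<exists>M. \<forall>m\<ge>M. \<forall>n\<ge>M. norm (seq_of (f m) k - seq_of (f n) k) < e"
      by (meson le_less_trans)
  qed
  have "\<exists>g. \<forall>k. (\<lambda>m. seq_of (f m) k) \<longlonglongrightarrow> g k"
    using coord by (intro choice allI) (simp add: Cauchy_convergent_iff convergent_def)
  then obtain g where g: "(\<lambda>m. seq_of (f m) k) \<longlonglongrightarrow> g k" for k
    by blast
  have close: "\<exists>M. \<forall>m\<ge>M. \<forall>k. \<bar>seq_of (f m) k - g k\<bar> \<le> e" if "0 < e" for e
  proof -
    obtain M where M: "\<forall>m\<ge>M. \<forall>n\<ge>M. norm (f m - f n) < e"
      using ev \<open>0 < e\<close> by blast
    have "\<bar>seq_of (f m) k - g k\<bar> \<le> e" if "m \<ge> M" for m k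
    proof (rule tendsto_upperbound)
      show "(\<lambda>n. \<bar>seq_of (f m) k - seq_of (f n) k\<bar>) \<longlonglongrightarrow> \<bar>seq_of (f m) k - g k\<bar>"
        by (intro tendsto_intros g)
      show "\<forall>\<^sub>F n in sequentially. \<bar>seq_of (f m) k - seq_of (f n) k\<bar> \<le> e"
        using eventually_ge_at_top[of M]
      proof eventually_elim
        case (elim n)
        with M that have "norm (f m - f n) < e"
          by blast
        with abs_seq_of_le_norm[of "f m - f n" k] show ?case
          by simp
      qed
    qed simp
    then show ?thesis by blast
  qed
  have "Cauchy g"
    unfolding Cauchy_iff
  proof (intro allI impI)
    fix e :: real assume "0 < e"
    then obtain m where m: "\<And>k. \<bar>seq_of (f m) k - g k\<bar> \<le> e / 4"
      using close[of "e / 4"] by auto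
    have "Cauchy (seq_of (f m))"
      by (rule convergent_Cauchy[OF convergent_seq_of])
    then obtain N where N: "\<forall>i\<ge>N. \<forall>j\<ge>N. \<bar>seq_of (f m) i - seq_of (f m) j\<bar> < e / 4"
      using \<open>0 < e\<close> unfolding Cauchy_iff real_norm_def by (auto dest: spec[of _ "e / 4"])
    have "norm (g i - g j) < e" if "i \<ge> N" "j \<ge> N" for i j
    proof -
      have "\<bar>seq_of (f m) i - seq_of (f m) j\<bar> < e / 4"
        using N that by blast
      with m[of i] m[of j] \<open>0 < e\<close> show ?thesis
        unfolding real_norm_def by linarith
    qed
    then show "\<exists>M. \<forall>i\<ge>M. \<forall>j\<ge>M. norm (g i - g j) < e"
      by blast
  qed
  then have "convergent g"
    by (rule Cauchy_convergent)
  then have seq_g: "seq_of (Cseq g) = g"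
    by (simp add: Cseq_inverse)
  have "f \<longlonglongrightarrow> Cseq g"
    unfolding LIMSEQ_iff
  proof (intro allI impI)
    fix e :: real assume "0 < e"
    then obtain M where "\<And>m k. m \<ge> M \<Longrightarrow> \<bar>seq_of (f m) k - g k\<bar> \<le> e / 2"
      using close[of "e / 2"] by auto
    then have "norm (f m - Cseq g) \<le> e / 2" if "m \<ge> M" for m
      using that by (intro norm_cseq_leI) (simp add: seq_g)
    then show "\<exists>M. \<forall>m\<ge>M. norm (f m - Cseq g) < e"
      using \<open>0 < e\<close> by (intro exI[of _ M]) (auto intro: le_less_trans[of _ "e / 2"])
  qed
  then show "convergent f"
    by (rule convergentI)
qed


section \<open>Groups of isomorphisms and isometries\<close>

definition operator_monoid :: "('a::banach \<Rightarrow>\<^sub>L 'a) monoid"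
  where "operator_monoid = \<lparr>carrier = UNIV, mult = (o\<^sub>L), one = id_blinfun\<rparr>"

lemma monoid_operator_monoid: "monoid operator_monoid"
  by unfold_locales (auto simp: operator_monoid_def intro!: blinfun_eqI)

definition GL :: "('a::banach \<Rightarrow>\<^sub>L 'a) monoid"
  where "GL = units_of operator_monoid"

lemma group_GL: "group (GL :: ('a::banach \<Rightarrow>\<^sub>L 'a) monoid)"
  unfolding GL_def by (rule monoid.units_group[OF monoid_operator_monoid])

definition Isom :: "('a::banach \<Rightarrow>\<^sub>L 'a) monoid"
  where "Isom = GL\<lparr>carrier := {T. surj (blinfun_apply T) \<and> (\<forall>x. norm (blinfun_apply T x) = norm x)}\<rparr>"

lemma carrier_GL_iff:
  "T \<in> carrier GL \<longleftrightarrow> (\<exists>S. S o\<^sub>L T = id_blinfun \<and> T o\<^sub>L S = id_blinfun)"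
  by (simp add: GL_def units_of_carrier Units_def operator_monoid_def)

lemma mult_GL [simp]: "T \<otimes>\<^bsub>GL\<^esub> S = T o\<^sub>L S"
  and one_GL [simp]: "\<one>\<^bsub>GL\<^esub> = id_blinfun"
  by (simp_all add: GL_def units_of_def operator_monoid_def)

lemma subgroup_Isom: "subgroup (carrier Isom) (GL :: ('a::banach \<Rightarrow>\<^sub>L 'a) monoid)"
proof -
  interpret GL: group "GL :: ('a \<Rightarrow>\<^sub>L 'a) monoid"
    by (rule group_GL)
  have inv: "\<exists>S\<in>carrier Isom. S o\<^sub>L T = id_blinfun \<and> T o\<^sub>L S = id_blinfun"
    if "T \<in> carrier Isom" for T :: "'a \<Rightarrow>\<^sub>L 'a"
  proof -
    have surj: "surj (blinfun_apply T)" and norm: "\<And>x. norm (blinfun_apply T x) = norm x"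
      using that by (auto simp: Isom_def)
    have inj: "inj (blinfun_apply T)"
    proof (rule injI)
      fix x y assume "blinfun_apply T x = blinfun_apply T y"
      then have "norm (x - y) = 0"
        using norm[of "x - y"] by (simp add: blinfun.diff_right)
      then show "x = y" by simp
    qed
    let ?g = "inv_into UNIV (blinfun_apply T)"
    have Tg: "blinfun_apply T (?g x) = x" for x
      by (rule surj_f_inv_f[OF surj])
    have gT: "?g (blinfun_apply T x) = x" for x
      by (rule inv_f_f[OF inj])
    have "bounded_linear ?g"
    proof (rule bounded_linear_intro[where K = 1])
      fix x y r
      show "?g (x + y) = ?g x + ?g y"
        by (rule injD[OF inj]) (simp add: Tg blinfun.add_right)
      show "?g (r *\<^sub>R x) = r *\<^sub>R ?g x"
        by (rule injD[OF inj]) (simp add: Tg blinfun.scaleR_right)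
      show "norm (?g x) \<le> norm x * 1"
        using norm[of "?g x"] by (simp add: Tg)
    qed
    then have app: "blinfun_apply (Blinfun ?g) = ?g"
      by (rule bounded_linear_Blinfun_apply)
    have "surj ?g"
      by (rule surjI[where f = "blinfun_apply T"]) (rule gT)
    moreover have "norm (?g x) = norm x" for x
      using norm[of "?g x"] by (simp add: Tg)
    ultimately have "Blinfun ?g \<in> carrier Isom"
      by (simp add: Isom_def app)
    moreover have "Blinfun ?g o\<^sub>L T = id_blinfun" "T o\<^sub>L Blinfun ?g = id_blinfun"
      by (auto intro!: blinfun_eqI simp: app gT Tg)
    ultimately show ?thesis by blast
  qed
  show ?thesis
  proof (rule GL.subgroupI)
    show "carrier Isom \<subseteq> carrier (GL :: ('a \<Rightarrow>\<^sub>L 'a) monoid)"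
      using inv unfolding carrier_GL_iff subset_eq by blast
    have "id_blinfun \<in> carrier (Isom :: ('a \<Rightarrow>\<^sub>L 'a) monoid)"
      by (auto simp: Isom_def)
    then show "carrier (Isom :: ('a \<Rightarrow>\<^sub>L 'a) monoid) \<noteq> {}"
      by blast
  next
    fix T :: "'a \<Rightarrow>\<^sub>L 'a" assume T: "T \<in> carrier Isom"
    then obtain S where S: "S \<in> carrier Isom" "S o\<^sub>L T = id_blinfun" "T o\<^sub>L S = id_blinfun"
      using inv by blast
    then have "inv\<^bsub>GL\<^esub> T = S"
      by (intro GL.inv_equality) (simp_all only: mult_GL one_GL carrier_GL_iff, blast+)
    with S show "inv\<^bsub>GL\<^esub> T \<in> carrier Isom" by simp
  next
    fix S T :: "'a \<Rightarrow>\<^sub>L 'a" assume "S \<in> carrier Isom" "T \<in> carrier Isom"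
    moreover have "surj (\<lambda>x. blinfun_apply S (blinfun_apply T x))"
      if "surj (blinfun_apply S)" "surj (blinfun_apply T)"
      using comp_surj[OF that(2,1)] by (simp add: comp_def)
    ultimately show "S \<otimes>\<^bsub>GL\<^esub> T \<in> carrier Isom"
      by (simp add: Isom_def)
  qed
qed

lemma group_Isom: "group (Isom :: ('a::banach \<Rightarrow>\<^sub>L 'a) monoid)"
proof -
  have "group ((GL :: ('a \<Rightarrow>\<^sub>L 'a) monoid)\<lparr>carrier := carrier (Isom :: ('a \<Rightarrow>\<^sub>L 'a) monoid)\<rparr>)"
    by (rule group.subgroup_imp_group[OF group_GL subgroup_Isom])
  then show ?thesis
    by (simp add: Isom_def)
qed


section \<open>Distinguished points, dual actions and light groups\<close>

text \<open>The infimum is taken in the extended reals, so that it is \<open>\<infinity>\<close> when \<open>G\<close> is trivial.\<close>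

definition distinguished_point :: "('a::banach \<Rightarrow>\<^sub>L 'a) set \<Rightarrow> 'a \<Rightarrow> bool"
  where "distinguished_point G x \<longleftrightarrow>
    (INF T\<in>G - {id_blinfun}. ereal (norm (blinfun_apply T x - x))) > 0"

definition dual_action :: "('a::banach \<Rightarrow>\<^sub>L 'a) \<Rightarrow> ('a \<Rightarrow>\<^sub>L real) \<Rightarrow>\<^sub>L ('a \<Rightarrow>\<^sub>L real)"
  where "dual_action T = Blinfun (\<lambda>f. f o\<^sub>L inv\<^bsub>GL\<^esub> T)"

lemma dual_action_apply [simp]:
  "blinfun_apply (dual_action T) f = f o\<^sub>L inv\<^bsub>GL\<^esub> T"
  unfolding dual_action_def
  by (subst bounded_linear_Blinfun_apply)
    (auto intro: bounded_bilinear.bounded_linear_left[OF bounded_bilinear_blinfun_compose])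

definition SOT_discrete :: "('a::banach \<Rightarrow>\<^sub>L 'a) set \<Rightarrow> bool"
  where "SOT_discrete S \<longleftrightarrow> subtopology strong_operator_topology S = discrete_topology S"

text \<open>The initial topology for the maps \<open>T \<mapsto> f (T x)\<close>: functions on
  \<open>'a \<times> ('a \<Rightarrow>\<^sub>L real)\<close> carry the product topology.\<close>

definition weak_operator_topology :: "('a::banach \<Rightarrow>\<^sub>L 'a) topology"
  where "weak_operator_topology =
    pullback_topology UNIV (\<lambda>T (x, f :: 'a \<Rightarrow>\<^sub>L real). blinfun_apply f (blinfun_apply T x)) euclidean"

definition light_group :: "('a::banach \<Rightarrow>\<^sub>L 'a) set \<Rightarrow> bool"
  where "light_group G \<longleftrightarrow>
    subtopology weak_operator_topology G = subtopology strong_operator_topology G"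

definition light_space :: "'a::banach itself \<Rightarrow> bool"
  where "light_space _ \<longleftrightarrow> light_group (carrier (Isom :: ('a \<Rightarrow>\<^sub>L 'a) monoid))"

end

theory Submission
  imports Defs
begin

text \<open>Let \<open>G\<close> be the group of all sign changes on finitely many coordinates. Every nontrivial
  element of \<open>G\<close> moves the constant sequence \<open>1\<close> by exactly \<open>2\<close>. Changing the sign of the \<open>n\<close>-th
  coordinate alone sends \<open>f\<close> in the dual of \<open>c\<close> to \<open>f - 2 f(e\<^sub>n) ev\<^sub>n\<close>, and \<open>f(e\<^sub>n)\<close> tends to \<open>0\<close>
  because \<open>(f(e\<^sub>n))\<close> is absolutely summable. Hence these sign changes converge to the
  identity strongly on the dual, and weakly (but not strongly) on \<open>c\<close>.\<close>

section \<open>Convergence criteria for the two operator topologies\<close>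

lemma pullback_openin_tendstoD:
  fixes g :: "'a \<Rightarrow> 'b::topological_space"
  assumes "openin (pullback_topology UNIV g euclidean) U" "a \<in> U"
    and "((\<lambda>n. g (h n)) \<longlongrightarrow> g a) F"
  shows "\<forall>\<^sub>F n in F. h n \<in> U"
proof -
  obtain V where V: "open V" "U = g -` V"
    using assms(1) by (auto simp: openin_pullback_topology)
  then have "\<forall>\<^sub>F n in F. g (h n) \<in> V"
    using assms(2,3) by (intro topological_tendstoD) auto
  then show ?thesis
    using V by simp
qed

lemma tendsto_funI:
  fixes g :: "'a \<Rightarrow> 'i \<Rightarrow> 'b::topological_space"
  assumes "\<And>i. ((\<lambda>n. g n i) \<longlongrightarrow> l i) F"
  shows "(g \<longlongrightarrow> l) F"
  using assms limitin_componentwise[of "\<lambda>_. euclidean" UNIV g l F]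
  by (simp add: euclidean_product_topology)

lemma SOT_tendstoD:
  assumes "openin strong_operator_topology U" "T \<in> U"
    and "\<And>x. ((\<lambda>n. blinfun_apply (S n) x) \<longlongrightarrow> blinfun_apply T x) F"
  shows "\<forall>\<^sub>F n in F. S n \<in> U"
  using assms unfolding strong_operator_topology_def
  by (intro pullback_openin_tendstoD[where g = blinfun_apply] tendsto_funI) auto

text \<open>The coordinates of the product are indexed by pairs \<open>(x, f)\<close>, so
  coordinatewise convergence is convergence of all the scalars \<open>f (S n x)\<close>.\<close>

lemma WOT_tendstoD:
  fixes T :: "'a::banach \<Rightarrow>\<^sub>L 'a" and S :: "'n \<Rightarrow> 'a \<Rightarrow>\<^sub>L 'a"
  assumes "openin weak_operator_topology U" "T \<in> U"
    and "\<And>x (f :: 'a \<Rightarrow>\<^sub>L real). ((\<lambda>n. f (S n x)) \<longlongrightarrow> f (T x)) F"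
  shows "\<forall>\<^sub>F n in F. S n \<in> U"
  using assms(2,3)
  by (intro pullback_openin_tendstoD[OF assms(1)[unfolded weak_operator_topology_def]] tendsto_funI)
    auto

section \<open>Unit vectors in c and functionals evaluated on them\<close>

definition unit_seq :: "nat \<Rightarrow> cseq"
  where "unit_seq k = Cseq (\<lambda>n. if n = k then 1 else 0)"

definition const_one :: cseq
  where "const_one = Cseq (\<lambda>_. 1)"

lemma convergent_unit_seq: "convergent (\<lambda>n. if n = k then 1 else (0::real))"
proof -
  have "(\<lambda>n. if n = k then 1 else (0::real)) \<longlonglongrightarrow> 0"
    by (rule tendsto_eventually) (use eventually_gt_at_top[of k] in eventually_elim, auto)
  then show ?thesis
    by (rule convergentI)
qed

lemma seq_of_unit_seq [simp]: "seq_of (unit_seq k) n = (if n = k then 1 else 0)"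
  unfolding unit_seq_def by (subst Cseq_inverse) (auto intro: convergent_unit_seq)

lemma seq_of_const_one [simp]: "seq_of const_one n = 1"
  unfolding const_one_def by (subst Cseq_inverse) (auto intro: convergent_const)

lemma seq_of_sum: "seq_of (sum x A) n = (\<Sum>a\<in>A. seq_of (x a) n)"
  by (induction A rule: infinite_finite_induct) auto

lemma dual_unit_seq_tendsto_0:
  fixes f :: "cseq \<Rightarrow>\<^sub>L real"
  shows "(\<lambda>n. f (unit_seq n)) \<longlonglongrightarrow> 0"
proof -
  have "(\<Sum>k<n. \<bar>f (unit_seq k)\<bar>) \<le> norm f" for n
  proof -
    \<comment> \<open>A test vector carrying the signs of \<open>f\<close> on the first
      \<open>n\<close> unit vectors: its coordinates lie in {-1, 0, 1}, and \<open>f\<close> maps it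
      to the partial sum, which is therefore at most \<open>norm f\<close>.\<close>
    let ?x = "\<Sum>k<n. sgn (f (unit_seq k)) *\<^sub>R unit_seq k"
    have "norm ?x \<le> 1"
    proof (rule norm_cseq_leI)
      fix m
      have "seq_of ?x m = (\<Sum>k<n. if m = k then sgn (f (unit_seq k)) else 0)"
        unfolding seq_of_sum by (rule sum.cong) auto
      then show "\<bar>seq_of ?x m\<bar> \<le> 1"
        by (auto simp: sgn_if)
    qed
    have "(\<Sum>k<n. \<bar>f (unit_seq k)\<bar>) = f ?x"
      by (simp add: blinfun.sum_right blinfun.scaleR_right abs_sgn mult.commute)
    also have "\<dots> \<le> norm f * norm ?x"
      using norm_blinfun[of f ?x] by simp
    also have "\<dots> \<le> norm f"
      using mult_left_mono[OF \<open>norm ?x \<le> 1\<close>, of "norm f"] by simp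
    finally show ?thesis .
  qed
  then have "summable (\<lambda>k. \<bar>f (unit_seq k)\<bar>)"
    by (intro summableI_nonneg_bounded) auto
  then show ?thesis
    using summable_LIMSEQ_zero tendsto_rabs_zero_iff by blast
qed

section \<open>The group of finite sign changes\<close>

definition flip :: "nat set \<Rightarrow> cseq \<Rightarrow>\<^sub>L cseq"
  where "flip A = Blinfun (\<lambda>x. x - (\<Sum>k\<in>A. (2 * seq_of x k) *\<^sub>R unit_seq k))"

lemma bounded_linear_seq_of: "bounded_linear (\<lambda>x. seq_of x k)"
  by (rule bounded_linear_intro[where K = 1]) (auto simp: abs_seq_of_le_norm)

lemma flip_apply: "flip A x = x - (\<Sum>k\<in>A. (2 * seq_of x k) *\<^sub>R unit_seq k)"
proof -
  have "bounded_linear (\<lambda>x. x - (\<Sum>k\<in>A. (2 * seq_of x k) *\<^sub>R unit_seq k))"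
    by (intro bounded_linear_intros bounded_linear_compose[OF bounded_linear_scaleR_left]
        bounded_linear_const_mult bounded_linear_seq_of)
  then show ?thesis
    by (simp add: flip_def bounded_linear_Blinfun_apply)
qed

text \<open>Finiteness matters here: over an infinite set the sum defaults to 0, and
  \<open>flip A\<close> is the identity.\<close>

lemma seq_of_flip:
  assumes "finite A"
  shows "seq_of (flip A x) n = (if n \<in> A then - seq_of x n else seq_of x n)"
proof -
  have "(\<Sum>k\<in>A. (2 * seq_of x k) * (if n = k then 1 else 0))
      = (\<Sum>k\<in>A. if n = k then 2 * seq_of x k else 0)"
    by (intro sum.cong) auto
  then show ?thesis
    using assms by (simp add: flip_apply seq_of_sum)
qed

lemma flip_empty: "flip {} = id_blinfun"
  by (rule blinfun_eqI) (simp add: flip_apply)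

text \<open>A coordinate flipped twice is restored, so composition becomes symmetric difference of
  the finite sets, and every element is an involution.\<close>

lemma flip_compose:
  assumes "finite A" "finite B"
  shows "flip A o\<^sub>L flip B = flip ((A - B) \<union> (B - A))"
  using assms by (auto intro!: blinfun_eqI cseq_eqI simp: seq_of_flip)

lemma flip_flip: "finite A \<Longrightarrow> flip A o\<^sub>L flip A = id_blinfun"
  by (simp add: flip_compose flip_empty)

text \<open>An involution is surjective, and the supremum norm sees only the absolute values of the
  coordinates.\<close>

lemma flip_in_Isom:
  assumes "finite A"
  shows "flip A \<in> carrier Isom"
proof -
  have "flip A (flip A x) = x" for x
    using arg_cong[OF flip_flip[OF assms], of "\<lambda>T. blinfun_apply T x"] by simp
  then have "surj (blinfun_apply (flip A))"
    by (rule surjI)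
  moreover have "norm (flip A x) = norm x" for x
    unfolding norm_cseq_def using assms by (auto simp: seq_of_flip intro!: SUP_cong)
  ultimately show ?thesis
    by (simp add: Isom_def)
qed

text \<open>Because of this, the dual action of a sign change is precomposition with the sign change
  itself.\<close>

lemma inv_GL_flip:
  assumes "finite A"
  shows "inv\<^bsub>GL\<^esub> (flip A) = flip A"
  by (intro group.inv_equality[OF group_GL])
    (use flip_flip[OF assms] in \<open>auto simp: carrier_GL_iff\<close>)

definition flips :: "(cseq \<Rightarrow>\<^sub>L cseq) set"
  where "flips = flip ` {A. finite A}"

lemma subgroup_flips: "subgroup flips Isom"
proof (rule group.subgroupI[OF group_Isom])
  have mult: "S \<otimes>\<^bsub>Isom\<^esub> T = S o\<^sub>L T" and one: "\<one>\<^bsub>Isom\<^esub> = id_blinfun" for S T :: "cseq \<Rightarrow>\<^sub>L cseq"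
    by (simp_all add: Isom_def)
  show "flips \<subseteq> carrier Isom"
    by (auto simp: flips_def flip_in_Isom)
  show "flips \<noteq> {}"
    by (auto simp: flips_def)
  show "inv\<^bsub>Isom\<^esub> T \<in> flips" if T: "T \<in> flips" for T
  proof -
    obtain A where A: "finite A" "T = flip A"
      using T by (auto simp: flips_def)
    have "inv\<^bsub>Isom\<^esub> T = T"
      using A flip_flip[of A] flip_in_Isom[of A]
      by (intro group.inv_equality[OF group_Isom]) (simp_all add: mult one)
    with T show ?thesis by simp
  qed
  show "S \<otimes>\<^bsub>Isom\<^esub> T \<in> flips" if "S \<in> flips" "T \<in> flips" for S T
    using that by (auto simp: flips_def mult flip_compose)
qed

section \<open>The constant sequence 1 as a distinguished point\<close>

lemma flip_moves_const_one:
  assumes "finite A" "A \<noteq> {}"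
  shows "2 \<le> norm (flip A const_one - const_one)"
proof -
  obtain n where "n \<in> A"
    using assms by blast
  then show ?thesis
    \<comment> \<open>At a coordinate in \<open>A\<close> the entry 1 becomes -1, a difference of
      absolute value 2.\<close>
    using abs_seq_of_le_norm[of "flip A const_one - const_one" n] assms
    by (simp add: seq_of_flip)
qed

lemma distinguished_point_flips: "distinguished_point flips const_one"
proof -
  have "ereal 2 \<le> (INF T\<in>flips - {id_blinfun}. ereal (norm (blinfun_apply T const_one - const_one)))"
  proof (rule INF_greatest)
    fix T assume "T \<in> flips - {id_blinfun}"
    then obtain A where "finite A" "A \<noteq> {}" "T = flip A"
      using flip_empty by (auto simp: flips_def)
    then show "ereal 2 \<le> ereal (norm (blinfun_apply T const_one - const_one))"
      using flip_moves_const_one by simp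
  qed
  then show ?thesis
    unfolding distinguished_point_def by (rule less_le_trans[rotated]) simp
qed

section \<open>Non-discreteness of the dual action\<close>

lemma flip_singleton_apply: "f (flip {n} x) = f x - 2 * seq_of x n * f (unit_seq n)"
  for f :: "cseq \<Rightarrow>\<^sub>L real"
  by (simp add: flip_apply blinfun.diff_right blinfun.scaleR_right)

lemma dual_action_flip_tendsto:
  "(\<lambda>n. dual_action (flip {n}) f) \<longlonglongrightarrow> f"
proof (rule LIM_zero_cancel, rule Lim_null_comparison)
  \<comment> \<open>The difference is a multiple of evaluation at coordinate \<open>n\<close>, a
    functional of norm at most 1, with coefficient \<open>-2 * f (unit_seq n)\<close>.\<close>
  show "\<forall>\<^sub>F n in sequentially. norm (dual_action (flip {n}) f - f) \<le> 2 * \<bar>f (unit_seq n)\<bar>"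
  proof (intro always_eventually allI norm_blinfun_bound)
    fix n x
    have "norm ((dual_action (flip {n}) f - f) x) = \<bar>seq_of x n\<bar> * (2 * \<bar>f (unit_seq n)\<bar>)"
      by (simp add: inv_GL_flip flip_singleton_apply blinfun.diff_left abs_mult)
    also have "\<dots> \<le> norm x * (2 * \<bar>f (unit_seq n)\<bar>)"
      by (intro mult_right_mono abs_seq_of_le_norm) simp
    finally show "norm ((dual_action (flip {n}) f - f) x) \<le> 2 * \<bar>f (unit_seq n)\<bar> * norm x"
      by (simp add: mult.commute)
  qed simp
  show "(\<lambda>n. 2 * \<bar>f (unit_seq n)\<bar>) \<longlonglongrightarrow> 0"
    by (intro tendsto_mult_right_zero tendsto_rabs_zero dual_unit_seq_tendsto_0)
qed

text \<open>Evaluation at coordinate \<open>n\<close> is sent to its negative, as its value at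
  \<open>const_one\<close> detects. Convergence to the identity refutes discreteness only if the
  approximating operators differ from it.\<close>

lemma dual_action_flip_neq_id: "dual_action (flip {n}) \<noteq> id_blinfun"
proof
  assume eq: "dual_action (flip {n}) = id_blinfun"
  define ev where "ev = Blinfun (\<lambda>x. seq_of x n)"
  have ev: "ev x = seq_of x n" for x
    by (simp add: ev_def bounded_linear_Blinfun_apply bounded_linear_seq_of)
  have "ev o\<^sub>L flip {n} = ev"
    using arg_cong[OF eq, of "\<lambda>T. blinfun_apply T ev"] by (simp add: inv_GL_flip)
  then have "ev (flip {n} const_one) = ev const_one"
    by (metis blinfun_apply_blinfun_compose)
  then show False
    by (simp add: ev seq_of_flip)
qed

lemma not_SOT_discrete_dual_action_flips: "\<not> SOT_discrete (dual_action ` flips)"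
proof
  assume "SOT_discrete (dual_action ` flips)"
  moreover have id: "id_blinfun \<in> dual_action ` flips"
  proof
    show "flip {} \<in> flips"
      by (auto simp: flips_def)
    show "id_blinfun = dual_action (flip {})"
      by (rule blinfun_eqI) (simp add: inv_GL_flip, rule blinfun_eqI, simp add: flip_empty)
  qed
  ultimately have "openin (subtopology strong_operator_topology (dual_action ` flips)) {id_blinfun}"
    by (simp add: SOT_discrete_def)
  \<comment> \<open>\<open>U\<close> would isolate the identity in the dual group, yet it eventually
    contains the dual operators of the single flips.\<close>
  then obtain U where U: "openin strong_operator_topology U"
    "{id_blinfun} = U \<inter> dual_action ` flips"
    by (auto simp: openin_subtopology)
  have "\<forall>\<^sub>F n in sequentially. dual_action (flip {n}) \<in> U"
    by (rule SOT_tendstoD[where T = id_blinfun]) (use U dual_action_flip_tendsto in auto)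
  then obtain n where "dual_action (flip {n}) \<in> U"
    using eventually_happens trivial_limit_sequentially by blast
  moreover have "flip {n} \<in> flips"
    by (auto simp: flips_def)
  ultimately have "dual_action (flip {n}) = id_blinfun"
    using U(2) by blast
  then show False
    using dual_action_flip_neq_id by blast
qed

section \<open>Failure of lightness of c\<close>

lemma not_light_cseq: "\<not> light_space TYPE(cseq)"
proof
  assume light: "light_space TYPE(cseq)"
  let ?I = "carrier (Isom :: (cseq \<Rightarrow>\<^sub>L cseq) monoid)"
  \<comment> \<open>The radius matches the displacement of \<open>const_one\<close> under nontrivial
    flips: the open ball of radius 2 excludes all of them.\<close>
  define U where "U = {T :: cseq \<Rightarrow>\<^sub>L cseq. T const_one \<in> ball const_one 2}"
  have "openin strong_operator_topology U"
    using openin_continuous_map_preimage[OF strong_operator_topology_continuous_evaluation, of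
        "ball const_one 2" const_one]
    by (simp add: U_def strong_operator_topology_topspace)
  then have "openin (subtopology weak_operator_topology ?I) (U \<inter> ?I)"
    using light unfolding light_space_def light_group_def by (auto simp: openin_subtopology)
  then obtain W where W: "openin weak_operator_topology W" "U \<inter> ?I = W \<inter> ?I"
    by (auto simp: openin_subtopology)
  have "id_blinfun \<in> U \<inter> ?I"
    using flip_in_Isom[of "{}"] by (simp add: U_def flip_empty)
  then have "id_blinfun \<in> W"
    using W by blast
  \<comment> \<open>Each flip is its own inverse, so \<open>f (flip {n} x)\<close> is the value at
    \<open>x\<close> of \<open>dual_action (flip {n}) f\<close>. Strong convergence on the dual thus
    yields weak convergence on c.\<close>
  have "(\<lambda>n. f (flip {n} x)) \<longlonglongrightarrow> f (id_blinfun x)" for x and f :: "cseq \<Rightarrow>\<^sub>L real"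
    using blinfun.tendsto[OF dual_action_flip_tendsto[of f] tendsto_const[of x]]
    by (simp add: inv_GL_flip)
  then have "\<forall>\<^sub>F n in sequentially. flip {n} \<in> W"
    by (rule WOT_tendstoD[OF W(1) \<open>id_blinfun \<in> W\<close>])
  then obtain n where "flip {n} \<in> W"
    using eventually_happens trivial_limit_sequentially by blast
  then have "flip {n} \<in> U"
    using W(2) flip_in_Isom[of "{n}"] by blast
  then show False
    using flip_moves_const_one[of "{n}"] by (simp add: U_def dist_norm norm_minus_commute)
qed

theorem proposition4p3:
  shows "(\<exists>G :: (cseq \<Rightarrow>\<^sub>L cseq) set.
            subgroup G Isom \<and>
            (\<exists>x. distinguished_point G x) \<and>
            \<not> SOT_discrete (dual_action ` G)) \<and>
         \<not> light_space TYPE(cseq)"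
  using subgroup_flips distinguished_point_flips not_SOT_discrete_dual_action_flips not_light_cseq
  by blast

end
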